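(* Let $r=[m_1,m_2,\dots,m_k]$ be a rational number with $0<r\le1$. Then the following hold. (1) Suppose $k=1$, i.e., $r=1/m_1$. Then $CS(r)=(\!(m_1,m_1)\!)$. (2) Suppose $k\ge2$. Then $CS(r)$ consists of $m_1$ and $m_1+1$; that is, the set of values of the terms of $CS(r)$ is $\{m_1,m_1+1\}$.
   Context: **Continued fractions.** $[m_1,\dots,m_k]=\cfrac{1}{m_1+\cfrac{1}{m_2+\cdots+\cfrac{1}{m_k}}}$. Every rational $r$ with $0<r\le1$ is written $r=[m_1,\dots,m_k]$ with $k\ge1$, $m_i$ positive integers, and $m_k\ge2$ unless $k=1$. **The word $u_r$.** For a positive rational number $r=q/p$ with $p,q$ relatively prime positive integers, set $\epsilon_i=(-1)^{\lfloor iq/p\rfloor}$ and define a word in the free generators $a,b$ by: - if $p$ is odd, $u_{q/p}=a\,\hat u_{q/p}\,b^{(-1)^q}\,\hat u_{q/p}^{-1}$ with $\hat u_{q/p}=b^{\epsilon_1}a^{\epsilon_2}\cdots b^{\epsilon_{p-2}}a^{\epsilon_{p-1}}$ (empty if $p=1$); - if $p$ is even, $u_{q/p}=a\,\hat u_{q/p}\,a^{-1}\,\hat u_{q/p}^{-1}$ with $\hat u_{q/p}=b^{\epsilon_1}a^{\epsilon_2}\cdots a^{\epsilon_{p-2}}b^{\epsilon_{p-1}}$. **Cyclic $S$-sequence.** For a cyclically reduced word $v$ in $\{a,b\}$, let $(v)$ be the cyclic word consisting of all its cyclic permutations. Decompose $(v)\equiv(v_1v_2\cdots v_t)$ into maximal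 blocks such that all letters in each $v_i$ have exponents of one sign and all letters in $v_{i+1}$ have exponents of the opposite sign (indices mod $t$). Then $CS(v):=(\!(|v_1|,|v_2|,\dots,|v_t|)\!)$, where $|\cdot|$ is word length and double parentheses mean the sequence is considered modulo cyclic permutations. For rational $0<r\le1$, put $CS(r):=CS(u_r)$. *)

theory Defs
  imports Complex_Main
begin

fun cfrac :: "nat list \<Rightarrow> rat" where
  "cfrac [] = 0"
| "cfrac (m # ms) = 1 / (of_nat m + cfrac ms)"

datatype gen = gen_a | gen_b

text \<open>A letter is a generator with an exponent; only the exponents \<open>1\<close> and \<open>-1\<close> are meant,
  so that the word length is the length of the list.\<close>

type_synonym letter = "gen \<times> int"
type_synonym word = "letter list"

definition inv_letter :: "letter \<Rightarrow> letter" where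
  "inv_letter x = (fst x, - snd x)"

definition inv_word :: "word \<Rightarrow> word" where
  "inv_word w = rev (map inv_letter w)"

definition is_word :: "word \<Rightarrow> bool" where
  "is_word w \<longleftrightarrow> (\<forall>x\<in>set w. snd x = 1 \<or> snd x = - 1)"

definition cyclically_reduced :: "word \<Rightarrow> bool" where
  "cyclically_reduced w \<longleftrightarrow>
     is_word w \<and> (\<forall>i<length w. w ! (Suc i mod length w) \<noteq> inv_letter (w ! i))"

text \<open>Here \<open>(i * q) div p\<close> is the floor of \<open>i q / p\<close>.\<close>

definition eps :: "nat \<Rightarrow> nat \<Rightarrow> nat \<Rightarrow> int" where
  "eps q p i = (- 1) ^ ((i * q) div p)"

text \<open>The generators of \<open>u_hat\<close> alternate, starting with \<open>gen_b\<close>; the last one, with index \<open>p - 1\<close>,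
  is therefore \<open>gen_a\<close> for odd \<open>p\<close> and \<open>gen_b\<close> for even \<open>p\<close>.\<close>

definition u_hat :: "nat \<Rightarrow> nat \<Rightarrow> word" where
  "u_hat q p = map (\<lambda>i. (if odd i then gen_b else gen_a, eps q p i)) [1..<p]"

definition u_frac :: "nat \<Rightarrow> nat \<Rightarrow> word" where
  "u_frac q p =
     (if odd p then [(gen_a, 1)] @ u_hat q p @ [(gen_b, (- 1) ^ q)] @ inv_word (u_hat q p)
      else [(gen_a, 1)] @ u_hat q p @ [(gen_a, - 1)] @ inv_word (u_hat q p))"

definition u_word :: "rat \<Rightarrow> word" where
  "u_word r = (case quotient_of r of (q, p) \<Rightarrow> u_frac (nat q) (nat p))"

text \<open>The words \<open>u_word r\<close> are cyclically reduced, because cyclically consecutive letters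
  involve different generators.\<close>

lemma u_frac_cyclically_reduced:
  assumes "0 < p"
  shows "cyclically_reduced (u_frac q p)"
proof -
  let ?w = "u_frac q p"
  have len: "length ?w = 2 * p"
    using assms by (auto simp: u_frac_def u_hat_def inv_word_def)
  have gen: "fst (?w ! i) = (if even i then gen_a else gen_b)" if "i < 2 * p" for i
  proof -
    have "i = 0 \<or> (0 < i \<and> i < p) \<or> i = p \<or> p < i" by linarith
    then show ?thesis
      using that assms
      by (auto simp: u_frac_def u_hat_def inv_word_def nth_append nth_Cons rev_nth inv_letter_def
          split: nat.splits; presburger)
  qed
  have "fst (?w ! (Suc i mod length ?w)) \<noteq> fst (?w ! i)" if "i < length ?w" for i
  proof -
    have "even (Suc i mod (2 * p)) \<longleftrightarrow> even (Suc i)"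
      by (simp add: dvd_mod_iff)
    then show ?thesis
      using gen[of i] gen[of "Suc i mod (2 * p)"] that assms by (auto simp: len)
  qed
  moreover have "is_word ?w"
  proof -
    have pm: "(- 1 :: int) ^ n = 1 \<or> (- 1 :: int) ^ n = - 1" for n
      by (cases "even n") auto
    have u: "snd x = 1 \<or> snd x = - 1" if "x \<in> set (u_hat q p)" for x
      using that pm[of "_ * q div p"] by (fastforce simp: u_hat_def eps_def)
    show ?thesis
      using pm u by (fastforce simp: is_word_def u_frac_def inv_word_def inv_letter_def)
  qed
  ultimately show ?thesis
    by (metis cyclically_reduced_def fst_conv inv_letter_def)
qed

lemma u_word_cyclically_reduced: "cyclically_reduced (u_word r)"
  using u_frac_cyclically_reduced quotient_of_denom_pos
  by (metis case_prod_conv u_word_def surj_pair zero_less_nat_eq)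

text \<open>Cyclic words and cyclic sequences are represented by the set of all cyclic permutations
  of a representative.\<close>

definition cyc :: "'c list \<Rightarrow> 'c list set" where
  "cyc xs = {rotate n xs |n. True}"

definition cyc_terms :: "'c list set \<Rightarrow> 'c set" where
  "cyc_terms s = (\<Union>xs\<in>s. set xs)"

definition pos_word :: "word \<Rightarrow> bool" where
  "pos_word w \<longleftrightarrow> (\<forall>x\<in>set w. snd x > 0)"

definition neg_word :: "word \<Rightarrow> bool" where
  "neg_word w \<longleftrightarrow> (\<forall>x\<in>set w. snd x < 0)"

definition opposite_signs :: "word \<Rightarrow> word \<Rightarrow> bool" where
  "opposite_signs v w \<longleftrightarrow> pos_word v \<and> neg_word w \<or> neg_word v \<and> pos_word w"

text \<open>Maximality of the blocks is the sign change between cyclically consecutive blocks.\<close>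

definition block_decomposition :: "word \<Rightarrow> word list \<Rightarrow> bool" where
  "block_decomposition v vs \<longleftrightarrow>
     cyc (concat vs) = cyc v \<and> [] \<notin> set vs \<and>
     (\<forall>i<length vs. opposite_signs (vs ! i) (vs ! (Suc i mod length vs)))"

text \<open>A block decomposition is unique up to cyclic permutation of its blocks; it exists whenever
  letters of both signs occur in the word.\<close>

definition CS_word :: "word \<Rightarrow> nat list set" where
  "CS_word v = (THE s. \<exists>vs. block_decomposition v vs \<and> s = cyc (map length vs))"

definition CS :: "rat \<Rightarrow> nat list set" where
  "CS r = CS_word (u_word r)"

end

theory Submission
  imports Defs
begin

text \<open>Write \<open>r = q/p\<close> in lowest terms. The word \<open>u_r\<close> has \<open>2p\<close> letters, and its definition
  hides a uniform description of their signs: the exponent of the letter at position \<open>i\<close> is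
  \<open>(-1)^n\<close> with \<open>n = \<lfloor>iq/p\<rfloor>\<close>, on the inverted second half as well as on the first
  (lemma \<open>sign_u_frac\<close>). So the letters with \<open>\<lfloor>iq/p\<rfloor> = n\<close> form the \<open>n\<close>-th sign block. There are
  \<open>2q\<close> of these, an even number, so that the signs alternate also across the end of the word, and
  \<open>q \<le> p\<close> makes them nonempty. The \<open>n\<close>-th block occupies the positions from \<open>\<lceil>np/q\<rceil>\<close> up to, but
  excluding, \<open>\<lceil>(n+1)p/q\<rceil>\<close>.

  Since \<open>p/q = m\<^sub>1 + x\<close> where \<open>x\<close> is the value of the tail of the continued fraction, the rest is
  counting. If the tail is empty, then \<open>q = 1\<close>, \<open>p = m\<^sub>1\<close>, and there are two blocks of length \<open>m\<^sub>1\<close>.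
  Otherwise \<open>0 < x < 1\<close>, every block has length \<open>m\<^sub>1\<close> or \<open>m\<^sub>1 + 1\<close>, and both lengths occur because
  the \<open>2q\<close> lengths have average \<open>p/q\<close>, which lies strictly between (lemma \<open>block_lengths_between\<close>).

  The cyclic sequence \<open>CS\<close> is a definite description, so this computes it only once a block
  decomposition is known to determine the cyclic sequence of block lengths. This is
  lemma \<open>CS_word_eq\<close>. It rests on the uniqueness of the decomposition of a linear word into
  blocks of alternating sign, together with the fact that two cyclic decompositions can differ by
  a rotation of the letters only if that rotation starts at a block boundary.\<close>

section \<open>Cyclic sequences\<close>

lemma cyc_rotate: "cyc (rotate j xs) = cyc xs"
proof (cases "xs = []")
  case False
  have "rotate n xs \<in> cyc (rotate j xs)" for n
  proof -
    \<comment> \<open>Rotating by \<open>j * (length xs - 1)\<close> undoes \<open>rotate j\<close>.\<close>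
    have "n + j * (length xs - 1) + j = n + j * length xs"
      using False by (cases xs) auto
    then have "rotate (n + j * (length xs - 1)) (rotate j xs) = rotate n xs"
      by (metis rotate_rotate rotate_conv_mod mod_mult_self1 mult.commute)
    then show ?thesis
      unfolding cyc_def by (metis (mono_tags, lifting) mem_Collect_eq)
  qed
  then show ?thesis
    by (auto simp: cyc_def rotate_rotate)
qed (simp add: cyc_def)

lemma cyc_self: "xs \<in> cyc xs"
  by (auto simp: cyc_def intro: exI[of _ 0])

lemma cyc_terms_cyc: "cyc_terms (cyc xs) = set xs"
  by (auto simp: cyc_terms_def cyc_def)

section \<open>Uniqueness of the block decomposition\<close>

lemma homogeneous_word_sign:
  assumes "pos_word w \<or> neg_word w" "x \<in> set w" "y \<in> set w"
  shows "0 < snd x * snd y"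
  using assms by (auto simp: pos_word_def neg_word_def intro: mult_pos_pos mult_neg_neg)

lemma opposite_signs_sign:
  assumes "opposite_signs v w" "x \<in> set v" "y \<in> set w"
  shows "snd x * snd y < 0"
  using assms by (auto simp: opposite_signs_def pos_word_def neg_word_def intro: mult_pos_neg mult_neg_pos)

text \<open>Having one sign is a separate condition since a single block has no neighbour that would
  force it.\<close>

definition alternating_blocks :: "word list \<Rightarrow> bool" where
  "alternating_blocks vs \<longleftrightarrow>
     [] \<notin> set vs \<and> (\<forall>v\<in>set vs. pos_word v \<or> neg_word v) \<and> successively opposite_signs vs"

lemma alternating_blocks_Cons:
  "alternating_blocks (v # vs) \<longleftrightarrow>
     v \<noteq> [] \<and> (pos_word v \<or> neg_word v) \<and> (vs = [] \<or> opposite_signs v (hd vs)) \<and>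
     alternating_blocks vs"
  by (auto simp: alternating_blocks_def successively_Cons)

text \<open>If the first block of one decomposition were a proper prefix of the first block of another,
  the letter after it would start the second block of the former, where the sign has changed, and
  still lie in the first block of the latter, where it has not.\<close>

lemma alternating_blocks_head_eq:
  assumes "alternating_blocks (v # vs)" "alternating_blocks (w # ws)"
    and "v @ us = w" and "us @ concat ws = concat vs"
  shows "us = []"
proof (rule ccontr)
  assume us: "us \<noteq> []"
  then obtain v' vs' where vs: "vs = v' # vs'" and ne: "v' \<noteq> []"
    using assms(1,4) by (cases vs) (auto simp: alternating_blocks_Cons)
  have hd: "hd us = hd v'"
    using assms(4) us ne vs by (metis concat.simps(2) hd_append2)
  have v: "v \<noteq> []"
    using assms(1) by (simp add: alternating_blocks_Cons)
  have "opposite_signs v v'" "pos_word w \<or> neg_word w"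
    using assms(1,2) vs by (auto simp: alternating_blocks_Cons)
  moreover have "hd v \<in> set v" "hd v \<in> set w"
    using v by (auto simp: assms(3)[symmetric])
  moreover have "hd us \<in> set w"
    using us by (simp add: assms(3)[symmetric])
  moreover have "hd us \<in> set v'"
    using ne by (simp add: hd)
  ultimately show False
    using homogeneous_word_sign opposite_signs_sign by (meson less_asym)
qed

lemma alternating_blocks_unique:
  assumes "alternating_blocks vs" "alternating_blocks ws" "concat vs = concat ws"
  shows "vs = ws"
  using assms
proof (induction vs arbitrary: ws)
  case Nil
  then show ?case
    by (cases ws) (auto simp: alternating_blocks_Cons)
next
  case (Cons v vs)
  then obtain w ws' where ws: "ws = w # ws'"
    by (cases ws) (auto simp: alternating_blocks_Cons)
  have "v @ concat vs = w @ concat ws'"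
    using Cons.prems ws by simp
  then obtain us where
    "v = w @ us \<and> us @ concat vs = concat ws' \<or> v @ us = w \<and> concat vs = us @ concat ws'"
    by (auto simp: append_eq_append_conv2)
  then have "v = w \<and> concat vs = concat ws'"
  proof (elim disjE conjE)
    assume eqs: "v = w @ us" "us @ concat vs = concat ws'"
    then have "us = []"
      by (rule alternating_blocks_head_eq[OF Cons.prems(2)[unfolded ws] Cons.prems(1) sym])
    then show ?thesis using eqs by simp
  next
    assume eqs: "v @ us = w" "concat vs = us @ concat ws'"
    then have "us = []"
      using alternating_blocks_head_eq[OF Cons.prems(1) Cons.prems(2)[unfolded ws]] by metis
    then show ?thesis using eqs by simp
  qed
  then show ?case
    using Cons.IH[of ws'] Cons.prems(1,2) by (simp add: ws alternating_blocks_Cons)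
qed

definition cyclic_blocks :: "word list \<Rightarrow> bool" where
  "cyclic_blocks vs \<longleftrightarrow>
     [] \<notin> set vs \<and> (\<forall>i<length vs. opposite_signs (vs ! i) (vs ! (Suc i mod length vs)))"

lemma cyclic_blocks_rotate:
  assumes "cyclic_blocks vs"
  shows "cyclic_blocks (rotate j vs)"
  unfolding cyclic_blocks_def
proof (intro conjI allI impI)
  show "[] \<notin> set (rotate j vs)"
    using assms by (simp add: cyclic_blocks_def)
  fix i assume i: "i < length (rotate j vs)"
  then have l: "length vs > 0" "i < length vs" by auto
  have "opposite_signs (vs ! ((j + i) mod length vs)) (vs ! (Suc ((j + i) mod length vs) mod length vs))"
    using assms l by (simp add: cyclic_blocks_def)
  then show "opposite_signs (rotate j vs ! i) (rotate j vs ! (Suc i mod length (rotate j vs)))"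
    using l by (simp add: nth_rotate mod_simps)
qed

lemma cyclic_blocks_alternating:
  assumes "cyclic_blocks vs"
  shows "alternating_blocks vs"
  unfolding alternating_blocks_def
proof (intro conjI ballI)
  show "[] \<notin> set vs"
    using assms by (simp add: cyclic_blocks_def)
  show "pos_word v \<or> neg_word v" if "v \<in> set vs" for v
    using assms that by (auto simp: cyclic_blocks_def in_set_conv_nth opposite_signs_def)
  show "successively opposite_signs vs"
    unfolding successively_conv_nth
  proof (intro allI impI)
    fix i assume "Suc i < length vs"
    then show "opposite_signs (vs ! i) (vs ! Suc i)"
      using assms unfolding cyclic_blocks_def by (metis Suc_lessD mod_less)
  qed
qed

lemma cyclic_blocks_sign_change:
  assumes "cyclic_blocks vs" "vs \<noteq> []"
  shows "snd (last (concat vs)) * snd (hd (concat vs)) < 0"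
proof -
  have ne: "hd vs \<noteq> []" "last vs \<noteq> []"
    using assms by (auto simp: cyclic_blocks_def) (metis hd_in_set, metis last_in_set)
  have "opposite_signs (vs ! (length vs - 1)) (vs ! (Suc (length vs - 1) mod length vs))"
    using assms unfolding cyclic_blocks_def by (metis diff_less length_greater_0_conv zero_less_one)
  then have op: "opposite_signs (last vs) (hd vs)"
    using assms(2) by (simp add: last_conv_nth hd_conv_nth)
  have "hd (concat vs) = hd (hd vs)"
    using ne assms(2) by (cases vs) auto
  moreover have "last (concat vs) = last (last vs)"
    using ne assms(2) by (cases vs rule: rev_cases) auto
  ultimately show ?thesis
    using opposite_signs_sign[OF op last_in_set[OF ne(2)] hd_in_set[OF ne(1)]] by simp
qed

text \<open>A position in a concatenation lies in one of the lists: \<open>k\<close> is the position of the first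
  letter of \<open>ys\<close>, and it starts a list exactly if \<open>xs\<close> is empty.\<close>

lemma split_concat:
  assumes "k < length (concat vs)"
  obtains xs ys vs1 vs2 where "vs = vs1 @ (xs @ ys) # vs2" "ys \<noteq> []"
    "k = length (concat vs1 @ xs)"
  using assms
proof (induction vs arbitrary: k thesis)
  case (Cons v vs)
  show ?case
  proof (cases "k < length v")
    case True
    show ?thesis
      by (rule Cons.prems(1)[of "[]" "take k v" "drop k v" vs]) (use True in auto)
  next
    case False
    then have "k - length v < length (concat vs)"
      using Cons.prems(2) by auto
    then obtain vs1 xs ys vs2 where
      "vs = vs1 @ (xs @ ys) # vs2" "ys \<noteq> []" "k - length v = length (concat vs1 @ xs)"
      using Cons.IH by blast
    then show ?thesis
      using False by (intro Cons.prems(1)[of "v # vs1" xs ys vs2]) auto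
  qed
qed simp

text \<open>The rotation taking the letters of \<open>vs\<close> to those of \<open>ws\<close> cannot cut a block of \<open>vs\<close>:
  otherwise the last and the first letter of \<open>concat ws\<close> would come from one block and have the same
  sign. It is therefore a rotation of the blocks, and the linear uniqueness applies.\<close>

lemma cyclic_blocks_unique:
  assumes vs: "cyclic_blocks vs" and ws: "cyclic_blocks ws"
    and "concat ws \<in> cyc (concat vs)"
  shows "\<exists>j. ws = rotate j vs"
proof (cases "concat vs = []")
  case True
  have "us = []" if "cyclic_blocks us" "concat us = []" for us
    using that by (cases us) (auto simp: cyclic_blocks_def)
  moreover have "concat ws = []"
    using assms(3) True by (auto simp: cyc_def)
  ultimately have "vs = []" "ws = []"
    using vs ws True by blast+
  then show ?thesis
    by simp
next
  case False
  obtain k' where "concat ws = rotate k' (concat vs)"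
    using assms(3) by (auto simp: cyc_def)
  then obtain k where k: "concat ws = rotate k (concat vs)" "k < length (concat vs)"
    by (metis False length_greater_0_conv mod_less_divisor rotate_conv_mod)
  obtain vs1 xs ys vs2 where d: "vs = vs1 @ (xs @ ys) # vs2" "ys \<noteq> []"
    "k = length (concat vs1 @ xs)"
    by (rule split_concat[OF k(2)])
  have cw: "concat ws = (ys @ concat vs2) @ (concat vs1 @ xs)"
    using k(1) rotate_append[of "concat vs1 @ xs" "ys @ concat vs2"] by (simp add: d)
  have "xs = []"
  proof (rule ccontr)
    assume xs: "xs \<noteq> []"
    have "ws \<noteq> []" using cw d by auto
    then have "snd (last xs) * snd (hd ys) < 0"
      using cyclic_blocks_sign_change[OF ws] cw d(2) xs by simp
    moreover have "pos_word (xs @ ys) \<or> neg_word (xs @ ys)"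
      using cyclic_blocks_alternating[OF vs] by (simp add: alternating_blocks_def d)
    ultimately show False
      using homogeneous_word_sign[of "xs @ ys" "last xs" "hd ys"] d(2) xs by simp
  qed
  then have "concat ws = concat (rotate (length vs1) vs)"
    by (simp add: cw d rotate_append)
  then have "ws = rotate (length vs1) vs"
    using alternating_blocks_unique cyclic_blocks_alternating cyclic_blocks_rotate vs ws
    by blast
  then show ?thesis by blast
qed

lemma CS_word_eq:
  assumes "block_decomposition v vs"
  shows "CS_word v = cyc (map length vs)"
  unfolding CS_word_def
proof (rule the_equality)
  show "\<exists>us. block_decomposition v us \<and> cyc (map length vs) = cyc (map length us)"
    using assms by blast
  fix s assume "\<exists>us. block_decomposition v us \<and> s = cyc (map length us)"
  then obtain us where us: "block_decomposition v us" "s = cyc (map length us)" by blast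
  have "concat us \<in> cyc (concat vs)"
    using us assms cyc_self by (metis block_decomposition_def)
  then obtain j where "us = rotate j vs"
    using cyclic_blocks_unique us assms
    by (metis block_decomposition_def cyclic_blocks_def)
  then show "s = cyc (map length vs)"
    by (simp add: us rotate_map[symmetric] cyc_rotate)
qed

section \<open>The blocks of the word of a fraction\<close>

lemma length_u_frac: "0 < p \<Longrightarrow> length (u_frac q p) = 2 * p"
  by (auto simp: u_frac_def u_hat_def inv_word_def)

text \<open>The numbers \<open>(p - j)q/p\<close> and \<open>(p + j)q/p\<close> add up to \<open>2q\<close> and are not integers, so their floors
  add up to \<open>2q - 1\<close>, which is odd.\<close>

lemma eps_reflect:
  assumes "coprime q p" "0 < j" "j < p"
  shows "eps q p (p + j) = - eps q p (p - j)"
proof -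
  define a where "a = ((p - j) * q) div p"
  define s where "s = ((p - j) * q) mod p"
  have A: "(p - j) * q = a * p + s"
    by (simp add: a_def s_def)
  have "\<not> p dvd (p - j) * q"
    using assms by (metis coprime_commute coprime_dvd_mult_left_iff diff_less dvd_imp_le
        linorder_not_less order.strict_trans zero_less_diff)
  then have s: "0 < s" "s < p"
    using assms by (auto simp: s_def mod_greater_zero_iff_not_dvd)
  have "(p - j) * q + (p + j) * q = (2 * q) * p"
    using assms by (simp flip: distrib_right)
  then have B: "(p + j) * q + s + a * p = (2 * q) * p"
    using A by simp
  then have "a * p < (2 * q) * p"
    using s by linarith
  then have "a < 2 * q"
    by simp
  then obtain b where b: "2 * q = a + b + 1"
    by (metis less_iff_Suc_add add.right_neutral add_Suc_right One_nat_def)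
  have "(p + j) * q + s = b * p + p"
    using B unfolding b by (simp only: add_mult_distrib mult_1)
  then have "((p + j) * q) div p = b"
    using s by (intro div_nat_eqI) (auto simp: algebra_simps)
  moreover have "even a \<longleftrightarrow> odd b"
    using b by presburger
  ultimately show ?thesis
    by (simp add: eps_def a_def[symmetric] minus_one_power_iff)
qed

text \<open>On the second half, position \<open>p + j\<close> holds the inverse of the letter at position \<open>p - j\<close>, which
  is why the reflection formula keeps the sign pattern going. The letter in the middle has
  exponent \<open>(-1)^q\<close> for even \<open>p\<close> too, as \<open>q\<close> is then odd.\<close>

lemma sign_u_frac:
  assumes cop: "coprime q p" and "i < 2 * p"
  shows "snd (u_frac q p ! i) = eps q p i"
proof -
  have p: "0 < p" using assms by auto
  define z where "z = (if odd p then (gen_b, (-1)^q) else (gen_a, -1 :: int))"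
  have u: "u_frac q p = (gen_a, 1) # u_hat q p @ z # inv_word (u_hat q p)"
    by (simp add: u_frac_def z_def)
  have z: "snd z = (-1)^q"
    using cop by (auto simp: z_def)
  have l: "length (u_hat q p) = p - 1"
    by (simp add: u_hat_def)
  consider "i = 0" | "0 < i" "i < p" | "i = p" | j where "i = p + j" "0 < j" "j < p"
    using assms(2) less_imp_add_positive[of p i] by (metis add_less_cancel_left linorder_neqE_nat mult_2 not_gr_zero)
  then show ?thesis
  proof cases
    case 1
    then show ?thesis by (simp add: u eps_def)
  next
    case 2
    then have "u_frac q p ! i = u_hat q p ! (i - 1)"
      by (auto simp: u nth_append l nth_Cons')
    then show ?thesis using 2 by (simp add: u_hat_def)
  next
    case 3
    then show ?thesis using p by (simp add: u nth_append l nth_Cons' z eps_def)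
  next
    case 4
    then have "u_frac q p ! i = inv_word (u_hat q p) ! (j - 1)"
      using p by (auto simp: u nth_append l nth_Cons')
    also have "\<dots> = inv_letter (u_hat q p ! (p - j - 1))"
      using 4 by (simp add: inv_word_def rev_nth l u_hat_def)
    finally have "snd (u_frac q p ! i) = - eps q p (p - j)"
      using 4 by (simp add: u_hat_def inv_letter_def Suc_diff_Suc)
    then show ?thesis
      using eps_reflect[OF cop] 4 by simp
  qed
qed

text \<open>This is \<open>\<lceil>np/q\<rceil>\<close>, the least \<open>i\<close> with \<open>\<lfloor>iq/p\<rfloor> \<ge> n\<close>.\<close>

definition block_start :: "nat \<Rightarrow> nat \<Rightarrow> nat \<Rightarrow> nat" where
  "block_start q p n = (n * p + (q - 1)) div q"

definition u_blocks :: "nat \<Rightarrow> nat \<Rightarrow> word list" where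
  "u_blocks q p =
     map (\<lambda>n. map ((!) (u_frac q p)) [block_start q p n..<block_start q p (Suc n)]) [0..<2 * q]"

lemma block_start_le_iff:
  assumes "0 < q"
  shows "block_start q p n \<le> i \<longleftrightarrow> n * p \<le> i * q"
proof -
  have "block_start q p n \<le> i \<longleftrightarrow> n * p + (q - 1) < Suc i * q"
    using assms by (simp add: block_start_def div_less_iff_less_mult flip: less_Suc_eq_le)
  then show ?thesis using assms by auto
qed

lemma block_start_mono: "block_start q p n \<le> block_start q p (Suc n)"
  by (simp add: block_start_def div_le_mono)

lemma block_start_step:
  assumes "0 < q" "q * m \<le> p" "p \<le> q * Suc m"
  shows "block_start q p n + m \<le> block_start q p (Suc n)"
    and "block_start q p (Suc n) \<le> block_start q p n + Suc m"
proof -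
  have add: "block_start q p n + d = (n * p + (q - 1) + q * d) div q" for d
    unfolding block_start_def using assms(1) div_mult_self2[of q "n * p + (q - 1)" d] by linarith
  show "block_start q p n + m \<le> block_start q p (Suc n)"
    unfolding add unfolding block_start_def using assms by (intro div_le_mono) auto
  show "block_start q p (Suc n) \<le> block_start q p n + Suc m"
    unfolding add unfolding block_start_def using assms by (intro div_le_mono) auto
qed

lemma concat_map_upt_blocks:
  assumes "\<And>n. f n \<le> f (Suc n)"
  shows "concat (map (\<lambda>n. map g [f n..<f (Suc n)]) [0..<k]) = map g [f 0..<f k]"
proof (induction k)
  case (Suc k)
  have "f 0 \<le> f k"
    using assms by (rule lift_Suc_mono_le) simp
  then have "[f 0..<f (Suc k)] = [f 0..<f k] @ [f k..<f (Suc k)]"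
    using assms[of k] upt_add_eq_append[of "f 0" "f k" "f (Suc k) - f k"] by simp
  then show ?case
    using Suc.IH by simp
qed simp

lemma concat_u_blocks:
  assumes "0 < q" "0 < p"
  shows "concat (u_blocks q p) = u_frac q p"
proof -
  have "block_start q p 0 = 0"
    using assms by (simp add: block_start_def)
  moreover have "block_start q p (2 * q) = 2 * p"
  proof -
    have "2 * q * p + (q - 1) = (2 * p) * q + (q - 1)" by simp
    then show ?thesis
      unfolding block_start_def using assms(1) div_mult_self3[of q "2 * p" "q - 1"] by simp
  qed
  ultimately show ?thesis
    unfolding u_blocks_def
    using concat_map_upt_blocks[of "block_start q p"] block_start_mono[of q p]
    by (metis length_u_frac[OF assms(2)] map_nth)
qed

lemma sign_u_block:
  assumes "coprime q p" "0 < q" "n < 2 * q" "x \<in> set (u_blocks q p ! n)"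
  shows "snd x = (-1) ^ n"
proof -
  obtain i where i: "block_start q p n \<le> i" "i < block_start q p (Suc n)" "x = u_frac q p ! i"
    using assms(3,4) by (auto simp: u_blocks_def)
  have lo: "n * p \<le> i * q"
    using i(1) block_start_le_iff[OF assms(2)] by blast
  have hi: "i * q < Suc n * p"
    using i(2) block_start_le_iff[OF assms(2), of p "Suc n" i] by linarith
  have "Suc n * p \<le> (2 * q) * p"
    using assms(3) by (intro mult_right_mono) auto
  then have "i * q < (2 * q) * p"
    using hi by linarith
  then have "i * q < (2 * p) * q"
    by (metis mult.assoc mult.commute)
  then have "i < 2 * p" by simp
  then have "snd x = eps q p i"
    using i(3) sign_u_frac[OF assms(1)] by simp
  moreover have "(i * q) div p = n"
    using lo hi by (intro div_nat_eqI) (auto simp: mult_ac)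
  ultimately show ?thesis by (simp add: eps_def)
qed

lemma length_u_blocks:
  "map length (u_blocks q p) =
     map (\<lambda>n. block_start q p (Suc n) - block_start q p n) [0..<2 * q]"
  by (simp add: u_blocks_def)

lemma block_decomposition_u_frac:
  assumes "coprime q p" "0 < q" "q \<le> p"
  shows "block_decomposition (u_frac q p) (u_blocks q p)"
  unfolding block_decomposition_def
proof (intro conjI allI impI)
  show "cyc (concat (u_blocks q p)) = cyc (u_frac q p)"
    using concat_u_blocks assms by simp
  \<comment> \<open>The length of a block is at least \<open>p div q\<close>, and \<open>q \<le> p\<close>.\<close>
  have less: "block_start q p n < block_start q p (Suc n)" for n
  proof -
    have "1 \<le> p div q"
      using assms by (simp add: div_greater_zero_iff Suc_le_eq)
    moreover have "block_start q p n + p div q \<le> block_start q p (Suc n)"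
      using assms dividend_less_times_div[of q p]
      by (intro block_start_step(1)) (auto simp: less_imp_le_nat)
    ultimately show ?thesis by linarith
  qed
  show "[] \<notin> set (u_blocks q p)"
  proof
    assume "[] \<in> set (u_blocks q p)"
    then obtain n where "[block_start q p n..<block_start q p (Suc n)] = []"
      unfolding u_blocks_def by (metis (no_types, lifting) ex_map_conv map_is_Nil_conv)
    then show False
      using less[of n] by simp
  qed
  fix i assume "i < length (u_blocks q p)"
  then have i: "i < 2 * q" by (simp add: u_blocks_def)
  have sign: "(even n \<longrightarrow> pos_word (u_blocks q p ! n)) \<and> (odd n \<longrightarrow> neg_word (u_blocks q p ! n))"
    if "n < 2 * q" for n
    using sign_u_block[OF assms(1,2) that] by (auto simp: pos_word_def neg_word_def)
  \<comment> \<open>The number of blocks is even, so the parity also changes from the last block to the first.\<close>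
  have "even (Suc i mod (2 * q)) \<longleftrightarrow> even (Suc i)"
    by (simp add: dvd_mod_iff)
  then show "opposite_signs (u_blocks q p ! i) (u_blocks q p ! (Suc i mod length (u_blocks q p)))"
    using sign[OF i] sign[of "Suc i mod (2 * q)"] i
    by (auto simp: opposite_signs_def u_blocks_def)
qed

text \<open>If all \<open>2q\<close> blocks had the same length \<open>c\<close>, comparing with the total length \<open>2p\<close> would give
  \<open>qc = p\<close>; but \<open>p\<close> lies strictly between \<open>qm\<close> and \<open>q(m + 1)\<close>.\<close>

lemma block_lengths_between:
  assumes "0 < q" "0 < p" "q * m < p" "p < q * Suc m"
  shows "set (map length (u_blocks q p)) = {m, Suc m}"
proof -
  let ?S = "map length (u_blocks q p)"
  have sub: "set ?S \<subseteq> {m, Suc m}"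
  proof -
    have "block_start q p (Suc n) - block_start q p n \<in> {m, Suc m}" for n
      using block_start_step[of q m p n] assms by auto
    then show ?thesis
      unfolding length_u_blocks by auto
  qed
  have sum: "sum_list ?S = 2 * p"
    using concat_u_blocks[OF assms(1,2)] length_u_frac[OF assms(2)]
    by (metis length_concat)
  have not_const: "\<not> set ?S \<subseteq> {c}" if "q * c \<noteq> p" for c
  proof
    assume "set ?S \<subseteq> {c}"
    then have "?S = replicate (length ?S) c"
      by (intro replicate_eqI) auto
    then have "sum_list ?S = length ?S * c"
      by (metis sum_list_replicate of_nat_id)
    then show False
      using sum that by (simp add: u_blocks_def)
  qed
  show ?thesis
    using sub not_const[of m] not_const[of "Suc m"] assms(3,4) by blast
qed

section \<open>Continued fractions\<close>

lemma cfrac_pos: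
  assumes "ms \<noteq> []" "\<forall>m\<in>set ms. 0 < m"
  shows "0 < cfrac ms"
  using assms
proof (induction ms)
  case (Cons m ms)
  then have "0 \<le> cfrac ms" by (cases ms) (auto simp: less_imp_le)
  then show ?case using Cons.prems by (simp add: add_pos_nonneg)
qed simp

text \<open>The condition on the last entry excludes \<open>[1]\<close>, the only list of positive entries whose value
  is not smaller than \<open>1\<close>.\<close>

lemma cfrac_less_1:
  assumes "ms \<noteq> []" "\<forall>m\<in>set ms. 0 < m" "2 \<le> last ms"
  shows "cfrac ms < 1"
proof -
  obtain m ns where ms: "ms = m # ns"
    using assms(1) by (cases ms) auto
  \<comment> \<open>The last entry is the first one if there is no other; otherwise the tail makes the
    inequality strict.\<close>
  have "1 < of_nat m + cfrac ns"
  proof (cases "ns = []")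
    case True
    then show ?thesis using assms ms by simp
  next
    case False
    then have "0 < cfrac ns" "1 \<le> m"
      using cfrac_pos assms(2) ms by (auto simp: Suc_le_eq)
    then show ?thesis
      by (metis add_mono_thms_linordered_field(4) add.right_neutral of_nat_1 of_nat_le_iff)
  qed
  then show ?thesis by (simp add: ms)
qed

theorem lemma4p4:
  fixes r :: rat and ms :: "nat list"
  assumes "0 < r" and "r \<le> 1"
    and "ms \<noteq> []"
    and "\<forall>m\<in>set ms. 0 < m"
    and "length ms \<noteq> 1 \<longrightarrow> 2 \<le> last ms"
    and "r = cfrac ms"
  shows "(length ms = 1 \<longrightarrow> CS r = cyc [ms ! 0, ms ! 0]) \<and>
         (2 \<le> length ms \<longrightarrow> cyc_terms (CS r) = {ms ! 0, ms ! 0 + 1})"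
proof -
  obtain Q P where QP: "quotient_of r = (Q, P)" by fastforce
  define q p where "q = nat Q" and "p = nat P"
  have "P > 0" using quotient_of_denom_pos QP by blast
  moreover have r0: "r = of_int Q / of_int P" using quotient_of_div QP by blast
  ultimately have "Q > 0" using assms(1) by (simp add: zero_less_divide_iff)
  have Q: "Q = int q" and P: "P = int p" and q: "0 < q" and p: "0 < p"
    using \<open>P > 0\<close> \<open>Q > 0\<close> by (simp_all add: q_def p_def)
  have cop: "coprime q p"
    using quotient_of_coprime[OF QP] by (simp add: Q P)
  have r: "r = of_nat q / of_nat p"
    using r0 by (simp add: Q P)
  have qp: "q \<le> p"
    using assms(2) p by (simp add: r)
  have CS: "CS r = cyc (map length (u_blocks q p))"
    using CS_word_eq[OF block_decomposition_u_frac[OF cop q qp]]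
    by (simp add: CS_def u_word_def QP q_def p_def)
  obtain m ns where ms: "ms = m # ns"
    using assms(3) by (cases ms) auto
  define x where "x = cfrac ns"
  have x0: "0 \<le> x"
    using cfrac_pos[of ns] assms(4) by (cases "ns = []") (auto simp: x_def ms less_imp_le)
  have "0 < m" using assms(4) ms by simp
  then have "of_nat m + x > 0" using x0 by (simp add: add_pos_nonneg)
  then have px: "of_nat p = of_nat q * (of_nat m + x)"
    using assms(6) p by (simp add: ms r x_def field_simps)
  show ?thesis
  proof (intro conjI impI)
    assume "length ms = 1"
    then have "x = 0" by (simp add: ms x_def)
    then have pm: "p = q * m"
      using px by (simp flip: of_nat_mult)
    then have "q = 1"
      using cop by simp
    then show "CS r = cyc [ms ! 0, ms ! 0]"
      using pm by (simp add: CS length_u_blocks block_start_def ms numeral_2_eq_2 upt_rec)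
  next
    assume "2 \<le> length ms"
    then have "ns \<noteq> []"
      by (auto simp: ms)
    then have "0 < x" "x < 1"
      using cfrac_pos[of ns] cfrac_less_1[of ns] assms(4,5) by (auto simp: ms x_def)
    then have "(of_nat (q * m) :: rat) < of_nat p" "of_nat p < (of_nat (q * Suc m) :: rat)"
      using q by (simp_all add: px algebra_simps)
    then have "set (map length (u_blocks q p)) = {m, Suc m}"
      using block_lengths_between q p of_nat_less_iff by blast
    then show "cyc_terms (CS r) = {ms ! 0, ms ! 0 + 1}"
      by (simp add: CS cyc_terms_cyc ms)
  qed
qed

end
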